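(* Let $G$ be a connected graph, let $v$ be a vertex of $G$, and let $u$ be a neighbor of $v$. If there exists a stabilized equitable partition $P$ centered at $v$ such that \[ P=\{V_0=\{v\},V_1=G(v),V_2,\dots,V_r\}, \] then the average hitting time from $u$ to $v$ is $\frac{2e}{k}-1$, where $e$ is the number of edges in the graph and $k$ is the degree of $v$.
   Context: Graphs are finite and undirected; $G(w)$ is the set of neighbours of a vertex $w$. A partition $P=\{V_0,\ldots,V_r\}$ of the vertex set is equitable if for all $i,j$ and all $w,w'\in V_j$, $|G(w)\cap V_i|=|G(w')\cap V_i|$. It is a stabilized equitable partition centered at $v$ if it is equitable and $V_0=\{v\}$. The average hitting time from $u$ to $v$ is the expected number of steps needed to reach $v$ for the first time in the simple random walk on $G$ started at $u$ (at each step the walk moves to a uniformly random neighbour of the current vertex). *)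

theory Defs
  imports "HOL-Probability.Probability" "Graph_Theory.Graph_Theory"
begin

text \<open>
  A finite simple undirected graph is a symmetric digraph without loops and multiple arcs
  (locale \<^locale>\<open>graph\<close>).  Each undirected edge is then represented by two opposite arcs, so
  edges are counted as unordered pairs of end points.
\<close>

definition neighbours :: "('a, 'b) pre_digraph \<Rightarrow> 'a \<Rightarrow> 'a set" where
  "neighbours G w = {x. w \<rightarrow>\<^bsub>G\<^esub> x}"

definition vertex_degree :: "('a, 'b) pre_digraph \<Rightarrow> 'a \<Rightarrow> nat" where
  "vertex_degree G w = card (neighbours G w)"

definition edges :: "('a, 'b) pre_digraph \<Rightarrow> 'a set set" where
  "edges G = (\<lambda>a. {tail G a, head G a}) ` arcs G"

definition equitable_partition :: "('a, 'b) pre_digraph \<Rightarrow> 'a set set \<Rightarrow> bool" where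
  "equitable_partition G P \<longleftrightarrow>
     partition_on (verts G) P \<and>
     (\<forall>A\<in>P. \<forall>B\<in>P. \<forall>w\<in>B. \<forall>w'\<in>B.
        card (neighbours G w \<inter> A) = card (neighbours G w' \<inter> A))"

definition stabilized_equitable_partition ::
  "('a, 'b) pre_digraph \<Rightarrow> 'a \<Rightarrow> 'a set set \<Rightarrow> bool" where
  "stabilized_equitable_partition G v P \<longleftrightarrow> equitable_partition G P \<and> {v} \<in> P"

text \<open>
  A process \<open>X\<close> on a probability space \<open>M\<close> is a simple random walk on \<open>G\<close> started at \<open>u\<close> if,
  conditionally on any history of positive probability, its next position is uniformly
  distributed on the neighbours of its current position.
\<close>

definition simple_random_walk ::
  "('a, 'b) pre_digraph \<Rightarrow> 'a \<Rightarrow> 'w measure \<Rightarrow> (nat \<Rightarrow> 'w \<Rightarrow> 'a) \<Rightarrow> bool" where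
  "simple_random_walk G u M X \<longleftrightarrow>
     prob_space M \<and>
     (\<forall>n. X n \<in> M \<rightarrow>\<^sub>M count_space (verts G)) \<and>
     (AE \<omega> in M. X 0 \<omega> = u) \<and>
     (\<forall>n x y. \<P>(\<omega> in M. \<forall>i\<le>n. X i \<omega> = x i) > 0 \<longrightarrow>
        \<P>(\<omega> in M. X (Suc n) \<omega> = y \<bar> \<forall>i\<le>n. X i \<omega> = x i) =
          (if y \<in> neighbours G (x n) then 1 / real (vertex_degree G (x n)) else 0))"

text \<open>The hitting time is \<open>\<infinity>\<close> (the infimum of the empty set) if \<open>v\<close> is never reached.\<close>

definition hitting_time :: "(nat \<Rightarrow> 'w \<Rightarrow> 'a) \<Rightarrow> 'a \<Rightarrow> 'w \<Rightarrow> ennreal" where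
  "hitting_time X v \<omega> = (INF n\<in>{n. X n \<omega> = v}. of_nat n)"

definition average_hitting_time :: "'w measure \<Rightarrow> (nat \<Rightarrow> 'w \<Rightarrow> 'a) \<Rightarrow> 'a \<Rightarrow> ennreal" where
  "average_hitting_time M X v = (\<integral>\<^sup>+\<omega>. hitting_time X v \<omega> \<partial>M)"

text \<open>
  Such a walk exists, on the space of trajectories, whenever no vertex is isolated (Ionescu-Tulcea
  theorem), so quantifying over \<open>M\<close> and \<open>X\<close> with \<^const>\<open>simple_random_walk\<close> is not vacuous.
\<close>

lemma simple_random_walk_exists:
  fixes G :: "('a, 'b) pre_digraph"
  assumes "fin_digraph G" and u: "u \<in> verts G"
    and ne: "\<And>w. w \<in> verts G \<Longrightarrow> neighbours G w \<noteq> {}"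
  shows "\<exists>M. simple_random_walk G u M (\<lambda>n (\<omega> :: nat \<Rightarrow> 'a). \<omega> n)"
proof -
  interpret fin_digraph G by fact
  define V where "V = verts G"
  define S where "S = count_space V"
  define q where "q i \<omega> y = (if i = 0 then if y = u then 1 else 0
      else if y \<in> neighbours G (\<omega> (i - 1)) then 1 / real (vertex_degree G (\<omega> (i - 1))) else 0)"
    for i :: nat and \<omega> :: "nat \<Rightarrow> 'a" and y
  define K where "K i \<omega> = point_measure V (\<lambda>y. ennreal (q i \<omega> y))" for i \<omega>
  have finV: "finite V" by (simp add: V_def)
  have NV: "neighbours G w \<subseteq> V" for w
    by (auto simp: neighbours_def V_def)
  have finN: "finite (neighbours G w)" for w using NV finV finite_subset by blast
  have q0: "q i \<omega> y \<ge> 0" for i \<omega> y by (auto simp: q_def)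
  have emK: "emeasure (K i \<omega>) {y} = ennreal (q i \<omega> y)" if "y \<in> V" for i \<omega> y
    using that unfolding K_def by (subst emeasure_point_measure_finite) (auto simp: finV)
  have sumq: "(\<Sum>y\<in>V. q i \<omega> y) = 1" if w: "\<omega> \<in> space (PiM {0..<i} (\<lambda>_. S))" for i \<omega>
  proof (cases i)
    case 0 then show ?thesis using u finV by (simp add: q_def V_def)
  next
    case (Suc j)
    then have "\<omega> j \<in> V" using w by (auto simp: space_PiM S_def PiE_iff)
    then have "card (neighbours G (\<omega> j)) > 0" using ne finN by (auto simp: V_def card_gt_0_iff)
    then show ?thesis using Suc NV finV
      by (simp add: q_def vertex_degree_def sum.If_cases Int_absorb1)
  qed
  have prK: "prob_space (K i \<omega>)" if "\<omega> \<in> space (PiM {0..<i} (\<lambda>_. S))" for i \<omega>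
    using sumq[OF that] q0
    by (intro prob_spaceI) (simp add: K_def emeasure_point_measure_finite finV space_point_measure sum_ennreal)
  have measK: "K i \<in> measurable (PiM {0..<i} (\<lambda>_. S)) (subprob_algebra S)" for i
  proof (cases i)
    case 0
    have "K i = (\<lambda>_. K 0 undefined)" using 0 by (auto simp: fun_eq_iff K_def q_def)
    moreover have "K 0 undefined \<in> space (subprob_algebra S)"
      using prK[of "\<lambda>_. undefined" 0]
      by (auto simp: space_subprob_algebra S_def K_def sets_point_measure space_PiM q_def prob_space_imp_subprob_space)
    ultimately show ?thesis by simp
  next
    case (Suc j)
    define k where "k w = K (Suc j) (\<lambda>_. w)" for w
    have "K i = (\<lambda>\<omega>. k (\<omega> j))" using Suc by (auto simp: fun_eq_iff K_def q_def k_def cong: if_cong)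
    moreover have "k \<in> measurable S (subprob_algebra S)"
    proof -
      have "k w \<in> space (subprob_algebra S)" if "w \<in> V" for w
      proof -
        have "K (Suc j) (restrict (\<lambda>_. w) {0..<Suc j}) = k w" by (simp add: k_def K_def q_def cong: if_cong)
        moreover have "prob_space (K (Suc j) (restrict (\<lambda>_. w) {0..<Suc j}))"
          using that by (intro prK) (auto simp: space_PiM S_def)
        ultimately show ?thesis
          by (auto simp: space_subprob_algebra S_def k_def K_def sets_point_measure prob_space_imp_subprob_space)
      qed
      then show ?thesis by (auto simp: S_def)
    qed
    moreover have "(\<lambda>\<omega>. \<omega> j) \<in> measurable (PiM {0..<i} (\<lambda>_. S)) S"
      using Suc by (intro measurable_component_singleton) auto
    ultimately show ?thesis by simp
  qed
  interpret IT: Ionescu_Tulcea K "\<lambda>_. S"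
    by (intro Ionescu_Tulcea.intro measK prK)
  define L where "L = IT.PF.lim"
  have sL[measurable_cong]: "sets L = sets (PiM UNIV (\<lambda>_. S))" unfolding L_def by (rule IT.PF.sets_lim)
  have spL: "space L = (UNIV \<rightarrow>\<^sub>E V)" using sets_eq_imp_space_eq[OF sL] by (simp add: space_PiM S_def)
  have sing: "{restrict x {0..<n}} \<in> sets (PiM {0..<n} (\<lambda>_. S))" if "\<And>i. i < n \<Longrightarrow> x i \<in> V" for x :: "nat \<Rightarrow> 'a" and n
  proof -
    have "{restrict x {0..<n}} = (\<Pi>\<^sub>E i\<in>{0..<n}. {x i})"
      by (auto simp: PiE_iff extensional_def fun_eq_iff) 
    also have "\<dots> \<in> sets (PiM {0..<n} (\<lambda>_. S))"
      using that by (intro sets_PiM_I_finite) (auto simp: S_def)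
    finally show ?thesis .
  qed
  have cyl: "emeasure L {\<omega>\<in>space L. \<forall>i<n. \<omega> i = x i} = emeasure (IT.C 0 n (\<lambda>_. undefined)) {restrict x {0..<n}}"
    if x: "\<And>i. i < n \<Longrightarrow> x i \<in> V" for x :: "nat \<Rightarrow> 'a" and n
  proof -
    have "{\<omega>\<in>space L. \<forall>i<n. \<omega> i = x i} = IT.PF.emb UNIV {0..<n} {restrict x {0..<n}}"
    proof -
      have "(\<forall>i<n. \<omega> i = x i) \<longleftrightarrow> restrict \<omega> {0..<n} = restrict x {0..<n}" for \<omega>
        by (metis atLeastLessThan_iff restrict_apply' restrict_ext zero_le)
      then show ?thesis by (auto simp: prod_emb_def spL space_PiM S_def)
    qed
    then have "emeasure L {\<omega>\<in>space L. \<forall>i<n. \<omega> i = x i} = emeasure (IT.CI {0..<n}) {restrict x {0..<n}}"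
      using IT.lim[of "{0..<n}"] sing[OF x] by (simp add: L_def)
    also have "\<dots> = emeasure (IT.C 0 n (\<lambda>_. undefined)) {restrict x {0..<n}}"
    proof -
      have "{restrict x {0..<n}} = IT.PF.emb {0..<n} {0..<n} {restrict x {0..<n}}"
        using sets.sets_into_space[OF sing[OF x]] by (simp add: prod_emb_id space_PiM)
      then show ?thesis
        using IT.emeasure_CI[of "{0..<n}" n "{restrict x {0..<n}}"] sing[OF x] by simp
    qed
    finally show ?thesis .
  qed
  have step: "emeasure (IT.C 0 (Suc n) (\<lambda>_. undefined)) {restrict x {0..<Suc n}} =
     emeasure (IT.C 0 n (\<lambda>_. undefined)) {restrict x {0..<n}} * ennreal (q n x (x n))"
    if x: "\<And>i. i < Suc n \<Longrightarrow> x i \<in> V" for x :: "nat \<Rightarrow> 'a" and n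
  proof -
    let ?C = "IT.C 0 n (\<lambda>_. undefined)"
    have un: "(\<lambda>_. undefined) \<in> space (PiM {0..<0::nat} (\<lambda>_. S))" by (auto simp: space_PiM PiE_iff)
    have sC: "sets ?C = sets (PiM {0..<n} (\<lambda>_. S))" using IT.sets_C[OF un, of n] by simp
    have spC: "space ?C = space (PiM {0..<n} (\<lambda>_. S))" using IT.space_C[OF un, of n] by simp
    have m: "IT.eP n \<in> measurable ?C (subprob_algebra (PiM {0..<Suc n} (\<lambda>_. S)))"
      using IT.measurable_eP[of n] measurable_cong_sets[OF sC refl] by blast
    have "emeasure (IT.C 0 (Suc n) (\<lambda>_. undefined)) {restrict x {0..<Suc n}} =
      (\<integral>\<^sup>+\<omega>. emeasure (IT.eP n \<omega>) {restrict x {0..<Suc n}} \<partial>?C)"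
      using IT.prob_space_C[OF un, of n] m sing[OF x]
      by (simp del: IT.C.simps(1)) (subst emeasure_bind[where N="PiM {0..<Suc n} (\<lambda>_. S)"], auto simp: prob_space.not_empty)
    also have "\<dots> = (\<integral>\<^sup>+\<omega>. ennreal (q n x (x n)) * indicator {restrict x {0..<n}} \<omega> \<partial>?C)"
    proof (rule nn_integral_cong)
      fix \<omega> assume "\<omega> \<in> space ?C"
      then have w: "\<omega> \<in> space (PiM {0..<n} (\<lambda>_. S))" using spC by simp
      have "emeasure (IT.eP n \<omega>) {restrict x {0..<Suc n}} =
         emeasure (K n \<omega>) ((\<lambda>y. fun_upd \<omega> n y) -` {restrict x {0..<Suc n}} \<inter> space S)"
        using IT.emeasure_eP[OF w sing[OF x]] by simp
      also have "(\<lambda>y. fun_upd \<omega> n y) -` {restrict x {0..<Suc n}} \<inter> space S =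
         (if \<omega> = restrict x {0..<n} then {x n} else {})"
      proof -
        have "fun_upd \<omega> n y = restrict x {0..<Suc n} \<longleftrightarrow> y = x n \<and> \<omega> = restrict x {0..<n}" for y
        proof
          assume h: "fun_upd \<omega> n y = restrict x {0..<Suc n}"
          have "\<omega> i = restrict x {0..<n} i" for i
            using fun_cong[OF h, of i] w
            by (cases "i < n") (auto simp: space_PiM PiE_iff extensional_def)
          then show "y = x n \<and> \<omega> = restrict x {0..<n}"
            using fun_cong[OF h, of n] by auto
        next
          assume "y = x n \<and> \<omega> = restrict x {0..<n}"
          then show "fun_upd \<omega> n y = restrict x {0..<Suc n}" by (auto simp: fun_eq_iff)
        qed
        then have "(\<lambda>y. fun_upd \<omega> n y) -` {restrict x {0..<Suc n}} \<inter> space S =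
          {y. y \<in> V \<and> y = x n \<and> \<omega> = restrict x {0..<n}}"
          unfolding S_def space_count_space by blast
        moreover have "x n \<in> V" using x[of n] by simp
        ultimately show ?thesis by (cases "\<omega> = restrict x {0..<n}") auto
      qed
      also have "emeasure (K n \<omega>) \<dots> = ennreal (q n x (x n)) * indicator {restrict x {0..<n}} \<omega>"
      proof (cases "\<omega> = restrict x {0..<n}")
        case True
        have "q n (restrict x {0..<n}) (x n) = q n x (x n)" by (cases n) (auto simp: q_def)
        with True show ?thesis using emK[of "x n" n \<omega>] x[of n] by simp
      qed auto
      finally show "emeasure (IT.eP n \<omega>) {restrict x {0..<Suc n}} =
        ennreal (q n x (x n)) * indicator {restrict x {0..<n}} \<omega>" .
    qed
    also have "\<dots> = emeasure ?C {restrict x {0..<n}} * ennreal (q n x (x n))"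
      using sing[of n x] x sC by (subst nn_integral_cmult_indicator) (auto simp: mult.commute)
    finally show ?thesis .
  qed
  have prL: "prob_space L"
  proof -
    have "emeasure L (space L) = emeasure (IT.C 0 0 (\<lambda>_. undefined)) {restrict undefined {0..<0::nat}}"
      using cyl[of 0 undefined] by simp
    also have "\<dots> = 1" by (simp add: PiM_empty restrict_def)
    finally show ?thesis by (rule prob_spaceI)
  qed
  interpret L: prob_space L by fact
  have Xm[measurable]: "(\<lambda>\<omega>. \<omega> n) \<in> measurable L S" for n
    using measurable_component_singleton[of n UNIV "\<lambda>_. S"] measurable_cong_sets[OF sL refl] by blast
  have stepL: "\<P>(\<omega> in L. \<forall>i<Suc n. \<omega> i = x i) = \<P>(\<omega> in L. \<forall>i<n. \<omega> i = x i) * q n x (x n)"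
    if x: "\<And>i. i < Suc n \<Longrightarrow> x i \<in> V" for x :: "nat \<Rightarrow> 'a" and n
  proof -
    have "emeasure L {\<omega>\<in>space L. \<forall>i<Suc n. \<omega> i = x i} = emeasure L {\<omega>\<in>space L. \<forall>i<n. \<omega> i = x i} * ennreal (q n x (x n))"
      using cyl[of "Suc n" x] cyl[of n x] step[of n x] x by simp
    then show ?thesis using q0 by (simp add: measure_def enn2real_mult)
  qed
  have "\<P>(\<omega> in L. \<forall>i<1. \<omega> i = u) = 1"
    using stepL[of 0 "\<lambda>_. u"] u L.prob_space by (simp add: q_def V_def)
  moreover have "{\<omega>\<in>space L. \<omega> 0 = u} \<in> sets L"
  proof -
    have "(\<lambda>\<omega>. \<omega> 0) -` {u} \<inter> space L \<in> sets L"
      using u by (intro measurable_sets[OF Xm]) (simp add: S_def V_def)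
    moreover have "(\<lambda>\<omega>. \<omega> 0) -` {u} \<inter> space L = {\<omega>\<in>space L. \<omega> 0 = u}" by blast
    ultimately show ?thesis by simp
  qed
  ultimately have "AE \<omega> in L. \<omega> 0 = u"
    using L.prob_Collect_eq_1[of "\<lambda>\<omega>. \<omega> 0 = u"] by simp
  moreover have "\<P>(\<omega> in L. \<omega> (Suc n) = y \<bar> \<forall>i\<le>n. \<omega> i = x i) =
          (if y \<in> neighbours G (x n) then 1 / real (vertex_degree G (x n)) else 0)"
    if pos: "\<P>(\<omega> in L. \<forall>i\<le>n. \<omega> i = x i) > 0" for n x y
  proof -
    have "{\<omega>\<in>space L. \<forall>i\<le>n. \<omega> i = x i} \<noteq> {}" using pos by fastforce
    then obtain \<omega> where "\<omega> \<in> space L" "\<forall>i\<le>n. \<omega> i = x i" by blast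
    then have xV: "x i \<in> V" if "i \<le> n" for i
      using that by (metis PiE_mem UNIV_I spL)
    show ?thesis
    proof (cases "y \<in> V")
      case False
      then have e: "{\<omega>\<in>space L. \<omega> (Suc n) = y \<and> (\<forall>i\<le>n. \<omega> i = x i)} = {}" by (auto simp: spL PiE_iff)
      have "y \<notin> neighbours G (x n)" using False NV by blast
      then show ?thesis unfolding cond_prob_def e by simp
    next
      case True
      let ?x = "fun_upd x (Suc n) y"
      have a: "{\<omega>\<in>space L. \<omega> (Suc n) = y \<and> (\<forall>i\<le>n. \<omega> i = x i)} = {\<omega>\<in>space L. \<forall>i<Suc (Suc n). \<omega> i = ?x i}"
        by (auto simp: less_Suc_eq_le le_Suc_eq)
      have b: "{\<omega>\<in>space L. \<forall>i\<le>n. \<omega> i = x i} = {\<omega>\<in>space L. \<forall>i<Suc n. \<omega> i = ?x i}"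
        by (auto simp: less_Suc_eq_le)
      have "\<P>(\<omega> in L. \<forall>i<Suc (Suc n). \<omega> i = ?x i) = \<P>(\<omega> in L. \<forall>i<Suc n. \<omega> i = ?x i) * q (Suc n) ?x y"
        using stepL[of "Suc n" ?x] xV True by (auto simp: less_Suc_eq_le)
      then show ?thesis unfolding cond_prob_def a using pos unfolding b by (simp add: q_def cong: if_cong)
    qed
  qed
  ultimately have "simple_random_walk G u L (\<lambda>n \<omega>. \<omega> n)"
    unfolding simple_random_walk_def using prL Xm by (auto simp: S_def V_def)
  then show ?thesis by blast
qed

end

theory Submission
  imports Defs
begin

text \<open>
  Let \<open>f n w\<close> be the probability that a walk from \<open>w\<close> avoids \<open>v\<close> at all times up to \<open>n\<close>.  The
  average hitting time from \<open>u\<close> is \<open>\<Sum>n. f n u\<close>, so it suffices to sum this series.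

  Weight \<open>f n\<close> with the degrees and put \<open>S n = (\<Sum>w. deg w * f n w)\<close>.  Multiplying the recursion for
  \<open>f\<close> by the degree gives \<open>deg w * f (n + 1) w = (\<Sum>x\<in>N(w). f n x)\<close> for every \<open>w \<noteq> v\<close>.  Summing it over
  these \<open>w\<close> and counting each pair of neighbours from the other end yields
  \<open>S (n + 1) = S n - (\<Sum>x\<in>N(v). f n x)\<close> (\<open>degree_weighted_avoidance_Suc\<close>).
  This holds in every finite graph.  The partition enters only here: \<open>f n\<close> is constant on the cells of
  an equitable partition that has \<open>{v}\<close> as a cell (\<open>avoidance_constant_on_cells\<close>), and \<open>N(v)\<close> is a
  cell, so the sum subtracted is \<open>k * f n u\<close>.  Hence \<open>k * (\<Sum>n<m. f n u) = S 0 - S m\<close>.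

  As \<open>S m \<ge> 0\<close>, the series converges, so \<open>f n x\<close> tends to \<open>0\<close> for each neighbour \<open>x\<close> of \<open>v\<close>.  This
  spreads along edges to the whole connected graph (\<open>avoidance_tendsto_0\<close>), whence \<open>S m\<close> tends to
  \<open>0\<close>.  Finally \<open>S 0\<close> is the sum of all degrees but that of \<open>v\<close>, which is \<open>2 * e - k\<close>, and dividing by
  \<open>k\<close> gives the formula.
\<close>

section \<open>The probability of not having hit the target\<close>

text \<open>The probability that a walk from \<open>w\<close> avoids \<open>v\<close> up to and including time \<open>n\<close>, by conditioning on
  the first step.  As a function of the start it can be compared across the cells of a partition.\<close>

primrec avoidance :: "('a, 'b) pre_digraph \<Rightarrow> 'a \<Rightarrow> nat \<Rightarrow> 'a \<Rightarrow> real" where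
  "avoidance G v 0 w = (if w = v then 0 else 1)"
| "avoidance G v (Suc n) w =
     (if w = v then 0 else (\<Sum>x\<in>neighbours G w. avoidance G v n x) / real (vertex_degree G w))"

definition step_prob :: "('a, 'b) pre_digraph \<Rightarrow> 'a \<Rightarrow> 'a \<Rightarrow> real" where
  "step_prob G x y = (if y \<in> neighbours G x then 1 / real (vertex_degree G x) else 0)"

lemma avoidance_nonneg: "avoidance G v n w \<ge> 0"
  by (induction n arbitrary: w) (auto intro!: divide_nonneg_nonneg sum_nonneg)

lemma avoidance_target [simp]: "avoidance G v n v = 0"
  by (cases n) auto

lemma (in wf_digraph) neighbours_subset: "neighbours G w \<subseteq> verts G"
  by (auto simp: neighbours_def)

lemma (in fin_digraph) finite_neighbours [simp]: "finite (neighbours G w)"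
  using neighbours_subset finite_verts finite_subset by blast

lemma (in sym_digraph) neighbours_sym: "x \<in> neighbours G y \<longleftrightarrow> y \<in> neighbours G x"
  using sym_arcs by (auto simp: neighbours_def symmetric_def dest: symD)

lemma (in fin_digraph) avoidance_Suc_step_prob:
  assumes "w \<noteq> v"
  shows "avoidance G v (Suc n) w = (\<Sum>y\<in>verts G. step_prob G w y * avoidance G v n y)"
proof -
  have "(\<Sum>y\<in>verts G. step_prob G w y * avoidance G v n y)
      = (\<Sum>y\<in>neighbours G w. step_prob G w y * avoidance G v n y)"
    using neighbours_subset by (intro sum.mono_neutral_right) (auto simp: step_prob_def)
  also have "\<dots> = avoidance G v (Suc n) w"
    using assms by (simp add: step_prob_def sum_divide_distrib)
  finally show ?thesis by simp
qed

lemma simple_random_walk_measurable: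
  assumes "simple_random_walk G u M X"
  shows "X n \<in> M \<rightarrow>\<^sub>M count_space UNIV"
proof -
  have "X n \<in> M \<rightarrow>\<^sub>M count_space (verts G)"
    using assms by (auto simp: simple_random_walk_def)
  then show ?thesis
    using measurable_compose[of "X n" M "count_space (verts G)" "\<lambda>x. x" "count_space UNIV"] by simp
qed

lemma simple_random_walk_in_verts:
  assumes "simple_random_walk G u M X" "\<omega> \<in> space M"
  shows "X n \<omega> \<in> verts G"
  using assms measurable_space[of "X n" M "count_space (verts G)" \<omega>]
  by (auto simp: simple_random_walk_def)

text \<open>The defining property of the walk speaks of complete histories only.  As there are finitely
  many of them, summing gives the Markov property for every event \<open>H\<close> of the past.\<close>

lemma (in fin_digraph) simple_random_walk_markov:
  assumes walk: "simple_random_walk G u M X"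
  shows "\<P>(\<omega> in M. restrict (\<lambda>i. X i \<omega>) {..n} \<in> H \<and> X n \<omega> = x \<and> X (Suc n) \<omega> = y)
       = \<P>(\<omega> in M. restrict (\<lambda>i. X i \<omega>) {..n} \<in> H \<and> X n \<omega> = x) * step_prob G x y"
proof -
  interpret prob_space M using walk by (simp add: simple_random_walk_def)
  note [measurable] = simple_random_walk_measurable[OF walk]
  define F where "F = {h \<in> {..n} \<rightarrow>\<^sub>E verts G. h \<in> H \<and> h n = x}"
  define C where "C h = {\<omega> \<in> space M. \<forall>i\<le>n. X i \<omega> = h i}" for h
  have finF: "finite F" unfolding F_def
    by (rule finite_subset[OF _ finite_PiE[of "{..n}" "\<lambda>_. verts G"]]) auto
  have agree: "(\<forall>i\<le>n. X i \<omega> = h i) \<longleftrightarrow> restrict (\<lambda>i. X i \<omega>) {..n} = h"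
    if "h \<in> F" for h \<omega>
    using that by (auto simp: F_def fun_eq_iff PiE_iff extensional_def)
  have in_F: "restrict (\<lambda>i. X i \<omega>) {..n} \<in> F \<longleftrightarrow> restrict (\<lambda>i. X i \<omega>) {..n} \<in> H \<and> X n \<omega> = x"
    if "\<omega> \<in> space M" for \<omega>
    using simple_random_walk_in_verts[OF walk that] by (auto simp: F_def)
  have one: "measure M {\<omega> \<in> C h. X (Suc n) \<omega> = y} = measure M (C h) * step_prob G x y"
    if h: "h \<in> F" for h
  proof (cases "measure M (C h) = 0")
    case True
    moreover have "measure M {\<omega> \<in> C h. X (Suc n) \<omega> = y} \<le> measure M (C h)"
      by (intro finite_measure_mono) (auto simp: C_def)
    ultimately show ?thesis using measure_nonneg[of M "{\<omega> \<in> C h. X (Suc n) \<omega> = y}"] by simp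
  next
    case False
    then have "\<P>(\<omega> in M. \<forall>i\<le>n. X i \<omega> = h i) > 0"
      by (simp add: C_def zero_less_measure_iff)
    then have "\<P>(\<omega> in M. X (Suc n) \<omega> = y \<bar> \<forall>i\<le>n. X i \<omega> = h i) = step_prob G (h n) y"
      using walk by (simp add: simple_random_walk_def step_prob_def)
    moreover have "{\<omega> \<in> space M. X (Suc n) \<omega> = y \<and> (\<forall>i\<le>n. X i \<omega> = h i)}
        = {\<omega> \<in> C h. X (Suc n) \<omega> = y}" by (auto simp: C_def)
    ultimately show ?thesis using False h by (simp add: cond_prob_def C_def F_def field_simps)
  qed
  have disj: "disjoint_family_on C F" "disjoint_family_on (\<lambda>h. {\<omega> \<in> C h. X (Suc n) \<omega> = y}) F"
    using agree by (auto simp: disjoint_family_on_def C_def)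
  have "{\<omega> \<in> space M. restrict (\<lambda>i. X i \<omega>) {..n} \<in> H \<and> X n \<omega> = x \<and> X (Suc n) \<omega> = y}
      = (\<Union>h\<in>F. {\<omega> \<in> C h. X (Suc n) \<omega> = y})"
    using agree in_F by (auto simp: C_def)
  then have "\<P>(\<omega> in M. restrict (\<lambda>i. X i \<omega>) {..n} \<in> H \<and> X n \<omega> = x \<and> X (Suc n) \<omega> = y)
      = (\<Sum>h\<in>F. measure M {\<omega> \<in> C h. X (Suc n) \<omega> = y})"
    using finF disj by (simp add: finite_measure_finite_Union image_subset_iff C_def)
  also have "\<dots> = (\<Sum>h\<in>F. measure M (C h)) * step_prob G x y"
    by (simp add: one sum_distrib_right)
  also have "(\<Sum>h\<in>F. measure M (C h)) = measure M (\<Union>h\<in>F. C h)"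
    by (rule finite_measure_finite_Union[OF finF _ disj(1), symmetric]) (auto simp: C_def)
  also have "(\<Union>h\<in>F. C h) = {\<omega> \<in> space M. restrict (\<lambda>i. X i \<omega>) {..n} \<in> H \<and> X n \<omega> = x}"
    using agree in_F by (auto simp: C_def)
  finally show ?thesis .
qed

text \<open>Averaging \<^const>\<open>avoidance\<close> over the position at time \<open>m\<close> of the walks that have not met \<open>v\<close>
  moves one step from the recursion into the process without changing the value.\<close>

lemma (in fin_digraph) avoidance_eq_prob_shifted:
  assumes walk: "simple_random_walk G u M X"
  shows "(\<Sum>x\<in>verts G. \<P>(\<omega> in M. (\<forall>i\<le>m. X i \<omega> \<noteq> v) \<and> X m \<omega> = x) * avoidance G v n x)
       = \<P>(\<omega> in M. \<forall>i\<le>m + n. X i \<omega> \<noteq> v)"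
proof (induction n arbitrary: m)
  interpret prob_space M using walk by (simp add: simple_random_walk_def)
  note [measurable] = simple_random_walk_measurable[OF walk]
  define g where "g m x = \<P>(\<omega> in M. (\<forall>i\<le>m. X i \<omega> \<noteq> v) \<and> X m \<omega> = x)" for m x
  have g_target: "g m v = 0" for m
  proof -
    have "{\<omega> \<in> space M. (\<forall>i\<le>m. X i \<omega> \<noteq> v) \<and> X m \<omega> = v} = {}" by auto
    then show ?thesis unfolding g_def by (simp only: measure_empty)
  qed
  have in_verts: "X i \<omega> \<in> verts G" if "\<omega> \<in> space M" for i \<omega>
    using simple_random_walk_in_verts[OF walk that] .
  {
    case 0
    have "(\<Sum>x\<in>verts G. g m x * avoidance G v 0 x) = (\<Sum>x\<in>verts G. g m x)"
      using g_target by (intro sum.cong) auto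
    also have "\<dots> = measure M (\<Union>x\<in>verts G. {\<omega> \<in> space M. (\<forall>i\<le>m. X i \<omega> \<noteq> v) \<and> X m \<omega> = x})"
      unfolding g_def
      by (intro finite_measure_finite_Union[symmetric]) (auto simp: disjoint_family_on_def)
    also have "(\<Union>x\<in>verts G. {\<omega> \<in> space M. (\<forall>i\<le>m. X i \<omega> \<noteq> v) \<and> X m \<omega> = x})
        = {\<omega> \<in> space M. \<forall>i\<le>m + 0. X i \<omega> \<noteq> v}"
      using in_verts by auto
    finally show ?case unfolding g_def .
  next
    case (Suc n)
    have g_Suc: "g (Suc m) y = (\<Sum>x\<in>verts G. g m x * step_prob G x y)" if "y \<noteq> v" for y
    proof -
      have hist: "restrict (\<lambda>i. X i \<omega>) {..m} \<in> {h. \<forall>i\<le>m. h i \<noteq> v} \<longleftrightarrow> (\<forall>i\<le>m. X i \<omega> \<noteq> v)" for \<omega>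
        by auto
      have "(\<Sum>x\<in>verts G. g m x * step_prob G x y)
          = (\<Sum>x\<in>verts G. \<P>(\<omega> in M. (\<forall>i\<le>m. X i \<omega> \<noteq> v) \<and> X m \<omega> = x \<and> X (Suc m) \<omega> = y))"
        using simple_random_walk_markov[OF walk, of m "{h. \<forall>i\<le>m. h i \<noteq> v}" _ y]
        unfolding g_def hist by simp
      also have "\<dots> = measure M (\<Union>x\<in>verts G.
          {\<omega> \<in> space M. (\<forall>i\<le>m. X i \<omega> \<noteq> v) \<and> X m \<omega> = x \<and> X (Suc m) \<omega> = y})"
        by (intro finite_measure_finite_Union[symmetric]) (auto simp: disjoint_family_on_def)
      also have "(\<Union>x\<in>verts G.
          {\<omega> \<in> space M. (\<forall>i\<le>m. X i \<omega> \<noteq> v) \<and> X m \<omega> = x \<and> X (Suc m) \<omega> = y})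
          = {\<omega> \<in> space M. (\<forall>i\<le>Suc m. X i \<omega> \<noteq> v) \<and> X (Suc m) \<omega> = y}"
        using in_verts that by (auto simp: le_Suc_eq)
      finally show ?thesis unfolding g_def by simp
    qed
    have "(\<Sum>x\<in>verts G. g m x * avoidance G v (Suc n) x)
        = (\<Sum>x\<in>verts G. \<Sum>y\<in>verts G. g m x * step_prob G x y * avoidance G v n y)"
    proof (rule sum.cong[OF refl])
      fix x
      show "g m x * avoidance G v (Suc n) x
          = (\<Sum>y\<in>verts G. g m x * step_prob G x y * avoidance G v n y)"
      proof (cases "x = v")
        case True then show ?thesis by (simp add: g_target)
      next
        case False
        then show ?thesis
          by (simp only: avoidance_Suc_step_prob[OF False] sum_distrib_left mult.assoc)
      qed
    qed
    also have "\<dots> = (\<Sum>y\<in>verts G. (\<Sum>x\<in>verts G. g m x * step_prob G x y) * avoidance G v n y)"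
      by (subst sum.swap) (simp add: sum_distrib_right)
    also have "\<dots> = (\<Sum>y\<in>verts G. g (Suc m) y * avoidance G v n y)"
    proof (rule sum.cong[OF refl])
      fix y
      show "(\<Sum>x\<in>verts G. g m x * step_prob G x y) * avoidance G v n y
          = g (Suc m) y * avoidance G v n y"
        by (cases "y = v") (simp_all add: g_Suc)
    qed
    also have "\<dots> = \<P>(\<omega> in M. \<forall>i\<le>m + Suc n. X i \<omega> \<noteq> v)"
      using Suc.IH[of "Suc m"] unfolding g_def by simp
    finally show ?case unfolding g_def .
  }
qed

lemma (in fin_digraph) avoidance_eq_prob:
  assumes walk: "simple_random_walk G u M X" and u: "u \<in> verts G"
  shows "\<P>(\<omega> in M. \<forall>i\<le>n. X i \<omega> \<noteq> v) = avoidance G v n u"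
proof -
  interpret prob_space M using walk by (simp add: simple_random_walk_def)
  note [measurable] = simple_random_walk_measurable[OF walk]
  have start: "AE \<omega> in M. X 0 \<omega> = u" using walk by (simp add: simple_random_walk_def)
  have "\<P>(\<omega> in M. (\<forall>i\<le>0. X i \<omega> \<noteq> v) \<and> X 0 \<omega> = x) = \<P>(\<omega> in M. u \<noteq> v \<and> u = x)" for x
    using start by (intro finite_measure_eq_AE) auto
  then have "\<P>(\<omega> in M. (\<forall>i\<le>0. X i \<omega> \<noteq> v) \<and> X 0 \<omega> = x) = (if x = u \<and> u \<noteq> v then 1 else 0)" for x
    using prob_space by auto
  then have "(\<Sum>x\<in>verts G. (if x = u \<and> u \<noteq> v then 1 else 0) * avoidance G v n x)
      = \<P>(\<omega> in M. \<forall>i\<le>n. X i \<omega> \<noteq> v)"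
    using avoidance_eq_prob_shifted[OF walk, of 0 v n] by simp
  moreover have "(\<Sum>x\<in>verts G. (if x = u \<and> u \<noteq> v then 1 else 0) * avoidance G v n x)
      = avoidance G v n u"
    using u by (cases "u = v") (simp_all add: if_distrib[of "\<lambda>c. c * _"] cong: if_cong)
  ultimately show ?thesis by simp
qed

section \<open>The average hitting time as a series\<close>

text \<open>The tail formula: the summand at \<open>n\<close> is the indicator of hitting \<open>v\<close> later than \<open>n\<close>.\<close>

lemma hitting_time_eq_suminf:
  "hitting_time X v \<omega> = (\<Sum>n. if \<forall>i\<le>n. X i \<omega> \<noteq> v then 1 else 0)"
proof (cases "\<exists>n. X n \<omega> = v")
  case False
  then have "hitting_time X v \<omega> = top" by (simp add: hitting_time_def)
  moreover have "(\<Sum>n. 1 :: ennreal) = top" 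
    by (simp add: suminf_eq_SUP ennreal_SUP_of_nat_eq_top)
  ultimately show ?thesis using False by simp
next
  case True
  define L where "L = (LEAST n. X n \<omega> = v)"
  have L: "X L \<omega> = v" "\<And>n. X n \<omega> = v \<Longrightarrow> L \<le> n"
    using True unfolding L_def by (auto intro: LeastI_ex Least_le)
  have avoid: "(\<forall>i\<le>n. X i \<omega> \<noteq> v) \<longleftrightarrow> n < L" for n
    using L(1) L(2) by (metis leI le_less_trans less_irrefl)
  have "hitting_time X v \<omega> = of_nat L"
    unfolding hitting_time_def using L by (intro antisym INF_lower INF_greatest) auto
  moreover have "(\<Sum>n. if n < L then 1 else 0 :: ennreal) = (\<Sum>n<L. if n < L then 1 else 0)"
    by (intro suminf_finite) auto
  ultimately show ?thesis by (simp add: avoid)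
qed

lemma (in fin_digraph) average_hitting_time_eq_suminf:
  assumes walk: "simple_random_walk G u M X" and u: "u \<in> verts G"
  shows "average_hitting_time M X v = (\<Sum>n. ennreal (avoidance G v n u))"
proof -
  interpret prob_space M using walk by (simp add: simple_random_walk_def)
  note [measurable] = simple_random_walk_measurable[OF walk]
  have "average_hitting_time M X v
      = (\<Sum>n. \<integral>\<^sup>+\<omega>. (if \<forall>i\<le>n. X i \<omega> \<noteq> v then 1 else 0) \<partial>M)"
    unfolding average_hitting_time_def hitting_time_eq_suminf
    by (intro nn_integral_suminf) measurable
  also have "\<dots> = (\<Sum>n. ennreal (avoidance G v n u))"
  proof (intro suminf_cong)
    fix n
    have "(\<integral>\<^sup>+\<omega>. (if \<forall>i\<le>n. X i \<omega> \<noteq> v then 1 else 0) \<partial>M)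
        = (\<integral>\<^sup>+\<omega>. indicator {\<omega> \<in> space M. \<forall>i\<le>n. X i \<omega> \<noteq> v} \<omega> \<partial>M)"
      by (intro nn_integral_cong) (auto simp: indicator_def)
    also have "\<dots> = ennreal (avoidance G v n u)"
      using avoidance_eq_prob[OF walk u, of n v] by (simp add: emeasure_eq_measure)
    finally show "(\<integral>\<^sup>+\<omega>. (if \<forall>i\<le>n. X i \<omega> \<noteq> v then 1 else 0) \<partial>M) = ennreal (avoidance G v n u)" .
  qed
  finally show ?thesis .
qed

section \<open>Equitable partitions\<close>

text \<open>Group a sum over the neighbours of \<open>w\<close> by cells: each cell contributes the common value of
  \<open>f\<close> on it times a count that equitability makes independent of the choice of \<open>w\<close>.\<close>

lemma (in fin_digraph) equitable_partition_sum_neighbours_eq: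
  fixes f :: "'a \<Rightarrow> real"
  assumes P: "equitable_partition G P" and B: "B \<in> P" "w \<in> B" "w' \<in> B"
    and f: "\<And>A x y. A \<in> P \<Longrightarrow> x \<in> A \<Longrightarrow> y \<in> A \<Longrightarrow> f x = f y"
  shows "(\<Sum>x\<in>neighbours G w. f x) = (\<Sum>x\<in>neighbours G w'. f x)"
proof -
  have part: "partition_on (verts G) P" using P by (simp add: equitable_partition_def)
  then have finP: "finite P" by (rule finite_elements[OF finite_verts])
  define F where "F A = f (SOME x. x \<in> A)" for A
  have F: "f x = F A" if "A \<in> P" "x \<in> A" for A x
    using f[of A x "SOME x. x \<in> A"] that someI[of "\<lambda>x. x \<in> A" x] by (simp add: F_def)
  have by_cells: "(\<Sum>x\<in>neighbours G z. f x) = (\<Sum>A\<in>P. real (card (neighbours G z \<inter> A)) * F A)" for z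
  proof -
    have "neighbours G z = (\<Union>A\<in>P. neighbours G z \<inter> A)"
      using neighbours_subset[of z] partition_onD1[OF part] by auto
    then have "(\<Sum>x\<in>neighbours G z. f x) = (\<Sum>x\<in>(\<Union>A\<in>P. neighbours G z \<inter> A). f x)"
      by (rule arg_cong)
    also have "\<dots> = (\<Sum>A\<in>P. \<Sum>x\<in>neighbours G z \<inter> A. f x)"
      using finP partition_onD2[OF part] by (intro sum.UNION_disjoint) (auto simp: disjoint_def)
    also have "\<dots> = (\<Sum>A\<in>P. \<Sum>x\<in>neighbours G z \<inter> A. F A)"
      using F by (intro sum.cong) auto
    finally show ?thesis by simp
  qed
  have "card (neighbours G w \<inter> A) = card (neighbours G w' \<inter> A)" if "A \<in> P" for A
    using P B that unfolding equitable_partition_def by blast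
  then show ?thesis unfolding by_cells by simp
qed

text \<open>Since \<open>{v}\<close> is a cell, the case distinction on \<open>w = v\<close> respects the cells; the degree and the
  sum over the neighbours are both sums of a function that is constant on cells.\<close>

lemma (in fin_digraph) avoidance_constant_on_cells:
  assumes P: "stabilized_equitable_partition G v P" and B: "B \<in> P" "w \<in> B" "w' \<in> B"
  shows "avoidance G v n w = avoidance G v n w'"
  using B
proof (induction n arbitrary: B w w')
  have eq: "equitable_partition G P" and cell: "{v} \<in> P"
    using P by (auto simp: stabilized_equitable_partition_def)
  have target: "x = v \<longleftrightarrow> y = v" if "A \<in> P" "x \<in> A" "y \<in> A" for A x y
  proof -
    have "A \<inter> {v} = {}" if "A \<noteq> {v}"
      using eq cell \<open>A \<in> P\<close> that
      unfolding equitable_partition_def partition_on_def by (intro disjointD[of P]) blast+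
    then show ?thesis using \<open>x \<in> A\<close> \<open>y \<in> A\<close> by blast
  qed
  {
    case 0
    then show ?case using target[OF 0] by simp
  next
    case (Suc n)
    have "real (vertex_degree G w) = real (vertex_degree G w')"
      using equitable_partition_sum_neighbours_eq[OF eq Suc.prems, of "\<lambda>_. 1"]
      by (simp add: vertex_degree_def)
    moreover have "(\<Sum>x\<in>neighbours G w. avoidance G v n x) = (\<Sum>x\<in>neighbours G w'. avoidance G v n x)"
      using Suc.IH by (rule equitable_partition_sum_neighbours_eq[OF eq Suc.prems])
    ultimately show ?case using target[OF Suc.prems] by simp
  }
qed

section \<open>Degree-weighted sums\<close>

lemma (in fin_digraph) degree_times_avoidance_Suc:
  assumes "w \<noteq> v"
  shows "real (vertex_degree G w) * avoidance G v (Suc n) w = (\<Sum>x\<in>neighbours G w. avoidance G v n x)"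
  using assms by (cases "neighbours G w = {}") (auto simp: vertex_degree_def)

lemma (in pseudo_graph) sum_sum_neighbours:
  fixes f :: "'a \<Rightarrow> real"
  shows "(\<Sum>w\<in>verts G. \<Sum>x\<in>neighbours G w. f x) = (\<Sum>x\<in>verts G. real (vertex_degree G x) * f x)"
proof -
  have "(\<Sum>w\<in>verts G. \<Sum>x\<in>neighbours G w. f x) = (\<Sum>w\<in>verts G. \<Sum>x\<in>{x\<in>verts G. x \<in> neighbours G w}. f x)"
    using neighbours_subset by (intro sum.cong) auto
  also have "\<dots> = (\<Sum>x\<in>verts G. \<Sum>w\<in>{w\<in>verts G. x \<in> neighbours G w}. f x)"
    by (rule sum.swap_restrict) auto
  also have "\<dots> = (\<Sum>x\<in>verts G. \<Sum>w\<in>neighbours G x. f x)"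
    using neighbours_subset neighbours_sym by (intro sum.cong) blast+
  finally show ?thesis by (simp add: vertex_degree_def)
qed

text \<open>The degrees form a stationary measure of the walk, so one step loses only the mass that
  arrives at \<open>v\<close>.\<close>

lemma (in pseudo_graph) degree_weighted_avoidance_Suc:
  assumes "v \<in> verts G"
  shows "(\<Sum>w\<in>verts G. real (vertex_degree G w) * avoidance G v (Suc n) w)
       = (\<Sum>w\<in>verts G. real (vertex_degree G w) * avoidance G v n w)
         - (\<Sum>x\<in>neighbours G v. avoidance G v n x)"
proof -
  have "(\<Sum>w\<in>verts G. real (vertex_degree G w) * avoidance G v (Suc n) w)
      = (\<Sum>w\<in>verts G - {v}. real (vertex_degree G w) * avoidance G v (Suc n) w)"
    by (intro sum.mono_neutral_right) auto
  also have "\<dots> = (\<Sum>w\<in>verts G - {v}. \<Sum>x\<in>neighbours G w. avoidance G v n x)"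
    by (intro sum.cong) (auto simp del: avoidance.simps simp: degree_times_avoidance_Suc)
  also have "\<dots> = (\<Sum>w\<in>verts G. \<Sum>x\<in>neighbours G w. avoidance G v n x)
      - (\<Sum>x\<in>neighbours G v. avoidance G v n x)"
    using assms by (simp add: sum_diff1)
  finally show ?thesis by (simp only: sum_sum_neighbours)
qed

text \<open>The handshake lemma: an unordered pair in \<^const>\<open>edges\<close> comes from exactly two opposite
  ordered pairs, which are distinct because there are no loops.\<close>

lemma (in graph) sum_vertex_degree: "(\<Sum>w\<in>verts G. vertex_degree G w) = 2 * card (edges G)"
proof -
  define e where "e p = {fst p, snd p}" for p :: "'a \<times> 'a"
  have fin: "finite (arcs_ends G)" by (simp add: arcs_ends_def)
  have edges_eq: "edges G = e ` arcs_ends G"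
    by (simp add: edges_def arcs_ends_def arc_to_ends_def e_def image_image)
  have sym: "(y, x) \<in> arcs_ends G" if "(x, y) \<in> arcs_ends G" for x y
    using that sym_arcs by (auto simp: symmetric_def dest: symD)
  have two: "card {q \<in> arcs_ends G. e q = E} = 2" if "E \<in> e ` arcs_ends G" for E
  proof -
    obtain p where p: "p \<in> arcs_ends G" "E = e p" using \<open>E \<in> e ` arcs_ends G\<close> by blast
    obtain x y where "p = (x, y)" by (cases p)
    then have xy: "(x, y) \<in> arcs_ends G" "E = {x, y}" using p by (auto simp: e_def)
    have "x \<noteq> y" using xy(1) adj_not_same by blast
    moreover have "{q \<in> arcs_ends G. e q = E} = {(x, y), (y, x)}"
      using xy(1) sym[OF xy(1)] unfolding xy(2) by (auto simp: e_def doubleton_eq_iff)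
    ultimately show ?thesis by simp
  qed
  have "(\<Sum>w\<in>verts G. vertex_degree G w) = card (SIGMA w:verts G. neighbours G w)"
    by (simp add: vertex_degree_def)
  also have "(SIGMA w:verts G. neighbours G w) = arcs_ends G"
    by (auto simp: neighbours_def)
  also have "card (arcs_ends G) = (\<Sum>E\<in>e ` arcs_ends G. card {q \<in> arcs_ends G. e q = E})"
    using sum.image_gen[OF fin, of "\<lambda>_. 1::nat" e] by simp
  also have "\<dots> = 2 * card (edges G)" by (simp add: two edges_eq)
  finally show ?thesis .
qed

section \<open>The walk is almost surely absorbed\<close>

text \<open>A neighbour \<open>x\<close> of \<open>w\<close> contributes to the average that defines \<^const>\<open>avoidance\<close> at \<open>w\<close>, so
  decay at \<open>w\<close> forces decay at \<open>x\<close>.\<close>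

lemma (in pseudo_graph) avoidance_tendsto_0:
  assumes conn: "Digraph_Component.connected G" and v: "v \<in> verts G" and w: "w \<in> verts G"
    and nbs: "\<And>x. x \<in> neighbours G v \<Longrightarrow> (\<lambda>n. avoidance G v n x) \<longlonglongrightarrow> 0"
  shows "(\<lambda>n. avoidance G v n w) \<longlonglongrightarrow> 0"
proof -
  have "strongly_connected G"
    using symmetric_connected_imp_strongly_connected[OF sym_arcs conn] .
  then have "v \<rightarrow>\<^sup>* w" using v w by (auto simp: strongly_connected_def)
  then show ?thesis
  proof (induction rule: reachable_induct)
    case base
    then show ?case by simp
  next
    case (step x y)
    then have y: "y \<in> neighbours G x" by (simp add: neighbours_def)
    show ?case
    proof (cases "x = v")
      case True then show ?thesis using nbs y by simp
    next
      case False
      have bound: "avoidance G v n y \<le> real (vertex_degree G x) * avoidance G v (Suc n) x" for n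
        unfolding degree_times_avoidance_Suc[OF False]
        using y by (intro member_le_sum) (auto simp: avoidance_nonneg)
      have lim: "(\<lambda>n. real (vertex_degree G x) * avoidance G v (Suc n) x) \<longlonglongrightarrow> 0"
        using tendsto_mult_left[OF LIMSEQ_Suc[OF step.IH]] by simp
      show ?thesis
        by (rule tendsto_sandwich[OF always_eventually always_eventually tendsto_const lim])
          (intro allI bound avoidance_nonneg)+
    qed
  qed
qed

section \<open>The hitting time of the centre\<close>

text \<open>The hypothesis \<open>const\<close> is what the equitable partition supplies.  It turns the mass lost at
  each step into a multiple of \<^const>\<open>avoidance\<close> at \<open>u\<close>, so that the partial sums telescope.\<close>

lemma (in graph) avoidance_sums:
  assumes conn: "Digraph_Component.connected G" and v: "v \<in> verts G" and u: "u \<in> neighbours G v"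
    and const: "\<And>n x. x \<in> neighbours G v \<Longrightarrow> avoidance G v n x = avoidance G v n u"
  shows "(\<lambda>n. avoidance G v n u) sums
           (2 * real (card (edges G)) / real (vertex_degree G v) - 1)"
proof -
  define S where "S n = (\<Sum>w\<in>verts G. real (vertex_degree G w) * avoidance G v n w)" for n
  define k where "k = real (vertex_degree G v)"
  have k: "k > 0" using u by (auto simp: k_def vertex_degree_def card_gt_0_iff)
  have S_Suc: "S (Suc n) = S n - k * avoidance G v n u" for n
    unfolding S_def degree_weighted_avoidance_Suc[OF v] by (simp add: const k_def vertex_degree_def)
  have partial: "(\<Sum>n<N. avoidance G v n u) = (S 0 - S N) / k" for N
    using k by (induction N) (simp_all add: S_Suc field_simps)
  have S_nonneg: "S n \<ge> 0" for n
    unfolding S_def by (intro sum_nonneg mult_nonneg_nonneg) (auto simp: avoidance_nonneg)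
  have "summable (\<lambda>n. avoidance G v n u)"
    by (rule summableI_nonneg_bounded[where x = "S 0 / k"])
      (use S_nonneg k in \<open>auto simp: avoidance_nonneg partial divide_right_mono\<close>)
  then have "(\<lambda>n. avoidance G v n u) \<longlonglongrightarrow> 0" by (rule summable_LIMSEQ_zero)
  then have "(\<lambda>n. avoidance G v n w) \<longlonglongrightarrow> 0" if "w \<in> verts G" for w
    using const by (intro avoidance_tendsto_0[OF conn v that]) simp
  then have "S \<longlonglongrightarrow> (\<Sum>w\<in>verts G. real (vertex_degree G w) * 0)"
    unfolding S_def[abs_def] by (intro tendsto_intros) auto
  then have "(\<lambda>N. (S 0 - S N) / k) \<longlonglongrightarrow> (S 0 - 0) / k"
    using k by (intro tendsto_intros) auto
  moreover have "S 0 = 2 * real (card (edges G)) - k"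
  proof -
    \<comment> \<open>At time \<open>0\<close> only \<open>v\<close> itself has been hit.\<close>
    have "S 0 = (\<Sum>w\<in>verts G - {v}. real (vertex_degree G w))"
      unfolding S_def by (intro sum.mono_neutral_cong_right) auto
    also have "\<dots> = real (\<Sum>w\<in>verts G. vertex_degree G w) - k"
      using v by (simp add: sum_diff1 k_def)
    finally show ?thesis by (simp add: sum_vertex_degree)
  qed
  ultimately have "(\<lambda>n. avoidance G v n u) sums ((2 * real (card (edges G)) - k) / k)"
    unfolding sums_def partial by simp
  then show ?thesis using k by (simp add: k_def diff_divide_distrib)
qed

theorem theorem4p5:
  fixes G :: "('a, 'b) pre_digraph" and u v :: 'a
    and M :: "'w measure" and X :: "nat \<Rightarrow> 'w \<Rightarrow> 'a"
  assumes "graph G" and "Digraph_Component.connected G"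
    and "v \<in> verts G" and "u \<in> neighbours G v"
    and "\<exists>P. stabilized_equitable_partition G v P \<and> neighbours G v \<in> P"
    and "simple_random_walk G u M X"
  shows "average_hitting_time M X v =
    ennreal (2 * real (card (edges G)) / real (vertex_degree G v) - 1)"
proof -
  interpret graph G by fact
  obtain P where P: "stabilized_equitable_partition G v P" "neighbours G v \<in> P"
    using assms(5) by blast
  have u: "u \<in> verts G" using assms(4) neighbours_subset by blast
  have "avoidance G v n x = avoidance G v n u" if "x \<in> neighbours G v" for n x
    using avoidance_constant_on_cells[OF P(1) P(2) that assms(4)] .
  then have sums: "(\<lambda>n. avoidance G v n u) sums
      (2 * real (card (edges G)) / real (vertex_degree G v) - 1)"
    by (intro avoidance_sums[OF assms(2-4)])
  have "average_hitting_time M X v = (\<Sum>n. ennreal (avoidance G v n u))"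
    by (rule average_hitting_time_eq_suminf[OF assms(6) u])
  also have "\<dots> = ennreal (\<Sum>n. avoidance G v n u)"
    using sums by (intro suminf_ennreal2) (auto simp: avoidance_nonneg sums_iff)
  also have "(\<Sum>n. avoidance G v n u) = 2 * real (card (edges G)) / real (vertex_degree G v) - 1"
    using sums by (simp add: sums_iff)
  finally show ?thesis .
qed

end
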